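(* Let $\mathbf{A}\in\mathbb{R}^{K\times K}$ be symmetric, and let $\mathbf{X}\in\mathbb{R}^{K\times|S|}$ be the real matrix obtained from its hemiplex Cholesky factorization as described in the context. Then the null space of $\mathbf{A}$ lies within the span of (the columns of) $\mathbf{X}$: if $\mathbf{v}\in\mathbb{R}^K$ and $\mathbf{A}\mathbf{v}=0$, then $\mathbf{v}=\mathbf{X}\boldsymbol{\alpha}$ for some $\boldsymbol{\alpha}\in\mathbb{R}^{|S|}$.
   Context: Hemiplex numbers. $\mathbb{J}$ is the real vector space of $z=a+m\mu+n\nu$ ($a,m,n\in\mathbb{R}$) with the $\mathbb{R}$-bilinear commutative (non-associative) multiplication with unit $1$ determined by $\mu^2=\nu^2=0$, $\mu\nu=\nu\mu=-\tfrac12$. Write $(z)_\mu=m$, $(z)_\nu=n$; $z$ is pure-hemi if $a=0$. Conjugation: $\bar z=a-m\mu-n\nu$; $|z|^2=z\bar z=a^2+mn\in\mathbb{R}$. Symmetric division of $c\in\mathbb{R}$ by $z$ with $|z|^2\ne0$ is $c/z=c\,\bar z/|z|^2$. $\mathbf{L}^*$ is the conjugate transpose. Factorization. Put $\mathbf{A}^{(1)}=\mathbf{A}$. For $j=1,\dots,K$, given the real symmetric matrix $\mathbf{A}^{(j)}$ with rows and columns indexed by $j,\dots,K$, set $d_j=\mathrm{sgn}(A^{(j)}_{jj})\in\{-1,0,1\}$; $\lambda_j=1$ if $A^{(j)}_{jj}=0$ and $\lambda_j=\sqrt{A^{(j)}_{jj}/d_j}$ otherwise; $L_{jj}=\lambda_j(\mu+d_j\nu)$;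 for $i>j$, $L_{ij}=\ell_{ij}(d_j\mu+\nu)$ with $\ell_{ij}=\dfrac{2A^{(j)}_{ij}}{\lambda_j(1+d_j^2)}$; for $i<j$, $L_{ij}=0$; and $A^{(j+1)}_{ik}=A^{(j)}_{ik}-L_{ij}\overline{L_{kj}}$ for $i,k>j$ (a real number). Then $\mathbf{A}=\mathbf{L}\mathbf{L}^*$. Let $S=\{i:d_i=0\}$, with elements $i_1<i_2<\dots<i_{|S|}$. The matrix $\mathbf{Y}$ ($K\times|S|$, pure-hemi entries). Column $q$ is defined by $Y_{iq}=0$ for $i<i_q$, $Y_{i_q q}=\mu$, and recursively for $i>i_q$ by $g_{iq}=-\sum_{j<i}L_{ij}Y_{jq}$ (real), $Y_{iq}=g_{iq}/L_{ii}$ (symmetric division) if $i\notin S$, and $Y_{iq}=-2g_{iq}\nu$ if $i\in S$. The matrix $\mathbf{X}$ ($K\times|S|$, real). Column $q$ is obtained by solving, for $i=K,K-1,\dots,1$, the equation $(\overline{L_{ii}})_\mu\,X_{iq}=(Y_{iq})_\mu-\sum_{j>i}(\overline{L_{ji}})_\mu\,X_{jq}$. *)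

theory Defs
  imports Complex_Main "Jordan_Normal_Form.Matrix"
begin

section \<open>Hemiplex numbers\<close>

text \<open>\<open>Hemi a m n\<close> stands for $a + m\mu + n\nu$.\<close>

datatype hemiplex = Hemi (hre: real) (hmu: real) (hnu: real)

lemma hemiplex_eq_iff: "z = w \<longleftrightarrow> hre z = hre w \<and> hmu z = hmu w \<and> hnu z = hnu w"
  by (cases z; cases w) auto

instantiation hemiplex :: real_vector
begin

definition "0 = Hemi 0 0 0"
definition "z + w = Hemi (hre z + hre w) (hmu z + hmu w) (hnu z + hnu w)"
definition "- z = Hemi (- hre z) (- hmu z) (- hnu z)"
definition "z - w = Hemi (hre z - hre w) (hmu z - hmu w) (hnu z - hnu w)"
definition "r *\<^sub>R z = Hemi (r * hre z) (r * hmu z) (r * hnu z)"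

instance
  by standard
    (simp_all add: hemiplex_eq_iff zero_hemiplex_def plus_hemiplex_def uminus_hemiplex_def
      minus_hemiplex_def scaleR_hemiplex_def algebra_simps)

end

text \<open>The product is not associative, so only the syntactic classes of \<open>1\<close> and \<open>*\<close> are
  instantiated. The formula is the bilinear extension of $\mu^2 = \nu^2 = 0$ and
  $\mu\nu = \nu\mu = -1/2$; see \<open>hemi_mult_table\<close> and \<open>hemi_mult_bilinear\<close>.\<close>

instantiation hemiplex :: "{one, times}"
begin

definition "1 = Hemi 1 0 0"
definition "z * w =
  Hemi (hre z * hre w - (hmu z * hnu w + hnu z * hmu w) / 2)
       (hre z * hmu w + hmu z * hre w)
       (hre z * hnu w + hnu z * hre w)"

instance ..

end

definition hemi_mu :: hemiplex where "hemi_mu = Hemi 0 1 0"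
definition hemi_nu :: hemiplex where "hemi_nu = Hemi 0 0 1"

lemmas hemi_defs = hemiplex_eq_iff zero_hemiplex_def plus_hemiplex_def uminus_hemiplex_def
  minus_hemiplex_def scaleR_hemiplex_def one_hemiplex_def times_hemiplex_def
  hemi_mu_def hemi_nu_def

lemma hemi_eq: "z = hre z *\<^sub>R 1 + hmu z *\<^sub>R hemi_mu + hnu z *\<^sub>R hemi_nu"
  by (simp add: hemi_defs)

lemma hemi_mult_table:
  "hemi_mu * hemi_mu = 0" "hemi_nu * hemi_nu = 0"
  "hemi_mu * hemi_nu = (- 1 / 2) *\<^sub>R 1" "hemi_nu * hemi_mu = (- 1 / 2) *\<^sub>R 1"
  "1 * z = z" "z * 1 = z" for z :: hemiplex
  by (simp_all add: hemi_defs)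

lemma hemi_mult_bilinear:
  fixes x y z :: hemiplex
  shows "x * y = y * x" "(x + y) * z = x * z + y * z" "x * (y + z) = x * y + x * z"
    "(r *\<^sub>R x) * y = r *\<^sub>R (x * y)" "x * (r *\<^sub>R y) = r *\<^sub>R (x * y)"
  by (simp_all add: hemi_defs field_simps)

definition hcnj :: "hemiplex \<Rightarrow> hemiplex" where
  "hcnj z = Hemi (hre z) (- hmu z) (- hnu z)"

definition hnormsq :: "hemiplex \<Rightarrow> real" where
  "hnormsq z = hre (z * hcnj z)"

lemma hemi_mult_hcnj: "z * hcnj z = hnormsq z *\<^sub>R 1"
  and hnormsq_eq: "hnormsq z = (hre z)\<^sup>2 + hmu z * hnu z"
  by (simp_all add: hnormsq_def hcnj_def hemi_defs power2_eq_square)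

definition pure_hemi :: "hemiplex \<Rightarrow> bool" where
  "pure_hemi z \<longleftrightarrow> hre z = 0"

lemma pure_hemi_mult: "pure_hemi z \<Longrightarrow> pure_hemi w \<Longrightarrow> z * w = hre (z * w) *\<^sub>R 1"
  by (simp add: pure_hemi_def hemi_defs)

text \<open>Symmetric division $c/z = c\,\bar z/|z|^2$ of a real number; meant for \<open>hnormsq z \<noteq> 0\<close>.\<close>

definition hdiv :: "real \<Rightarrow> hemiplex \<Rightarrow> hemiplex" where
  "hdiv c z = (c *\<^sub>R hcnj z) /\<^sub>R hnormsq z"


section \<open>Hemiplex Cholesky factorization\<close>

text \<open>All indices start at 0, so \<open>hchol_schur A j\<close> is $\mathbf A^{(j+1)}$ in the usual
  1-based numbering. In \<open>hchol_pivot B j\<close>, \<open>hchol_scale B j\<close> and \<open>hchol_col B j\<close> the argument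
  \<open>B\<close> is the current Schur complement, and the results are $d_j$, $\lambda_j$ and
  column \<open>j\<close> of $\mathbf L$.\<close>

definition hchol_pivot :: "(nat \<Rightarrow> nat \<Rightarrow> real) \<Rightarrow> nat \<Rightarrow> real" where
  "hchol_pivot B j = sgn (B j j)"

definition hchol_scale :: "(nat \<Rightarrow> nat \<Rightarrow> real) \<Rightarrow> nat \<Rightarrow> real" where
  "hchol_scale B j = (if B j j = 0 then 1 else sqrt (B j j / hchol_pivot B j))"

definition hchol_col :: "(nat \<Rightarrow> nat \<Rightarrow> real) \<Rightarrow> nat \<Rightarrow> nat \<Rightarrow> hemiplex" where
  "hchol_col B j i =
    (let d = hchol_pivot B j; l = hchol_scale B j in
     if i < j then 0
     else if i = j then l *\<^sub>R (hemi_mu + d *\<^sub>R hemi_nu)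
     else (2 * B i j / (l * (1 + d\<^sup>2))) *\<^sub>R (d *\<^sub>R hemi_mu + hemi_nu))"

lemma pure_hemi_hchol_col: "pure_hemi (hchol_col B j i)"
  by (simp add: pure_hemi_def hchol_col_def Let_def hemi_defs)

text \<open>Only the values at \<open>i \<ge> j\<close> and \<open>k \<ge> j\<close> of \<open>hchol_schur A j i k\<close> are meaningful; no other
  values enter the factorization. The product subtracted is real because both factors are
  pure-hemi, hence \<open>hre\<close> loses nothing.\<close>

primrec hchol_schur :: "real mat \<Rightarrow> nat \<Rightarrow> nat \<Rightarrow> nat \<Rightarrow> real" where
  "hchol_schur A 0 = (\<lambda>i k. A $$ (i, k))"
| "hchol_schur A (Suc j) = (\<lambda>i k. hchol_schur A j i k -
     hre (hchol_col (hchol_schur A j) j i * hcnj (hchol_col (hchol_schur A j) j k)))"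

definition hchol :: "real mat \<Rightarrow> hemiplex mat" where
  "hchol A = mat (dim_row A) (dim_row A) (\<lambda>(i, j). hchol_col (hchol_schur A j) j i)"

definition hchol_zero_pivots :: "real mat \<Rightarrow> nat set" where
  "hchol_zero_pivots A = {i. i < dim_row A \<and> hchol_pivot (hchol_schur A i) i = 0}"


section \<open>The matrices Y and X\<close>

text \<open>\<open>hchol_Y_col A s\<close> is the column of $\mathbf Y$ that belongs to the zero pivot \<open>s\<close>, i.e.
  $s = i_q$. The sum is real because all its terms are products of pure-hemi numbers.\<close>

fun hchol_Y_col :: "real mat \<Rightarrow> nat \<Rightarrow> nat \<Rightarrow> hemiplex" where
  "hchol_Y_col A s i =
    (if i < s then 0
     else if i = s then hemi_mu
     else let g = - hre (\<Sum>j<i. hchol A $$ (i, j) * hchol_Y_col A s j)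
       in if i \<notin> hchol_zero_pivots A then hdiv g (hchol A $$ (i, i)) else (- 2 * g) *\<^sub>R hemi_nu)"

definition hchol_Y :: "real mat \<Rightarrow> hemiplex mat" where
  "hchol_Y A = mat (dim_row A) (card (hchol_zero_pivots A))
    (\<lambda>(i, q). hchol_Y_col A (sorted_list_of_set (hchol_zero_pivots A) ! q) i)"

text \<open>Back substitution, each equation solved for its unknown; see \<open>hchol_X_equation\<close>.\<close>

function hchol_X_entry :: "real mat \<Rightarrow> nat \<Rightarrow> nat \<Rightarrow> real" where
  "hchol_X_entry A q i =
    (hmu (hchol_Y A $$ (i, q)) -
      (\<Sum>j\<in>{i<..<dim_row A}. hmu (hcnj (hchol A $$ (j, i))) * hchol_X_entry A q j))
    / hmu (hcnj (hchol A $$ (i, i)))"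
  by pat_completeness auto
termination
  by (relation "measure (\<lambda>(A, q, i). dim_row A - i)") auto

declare hchol_Y_col.simps [simp del] hchol_X_entry.simps [simp del]

definition hchol_X :: "real mat \<Rightarrow> real mat" where
  "hchol_X A = mat (dim_row A) (card (hchol_zero_pivots A)) (\<lambda>(i, q). hchol_X_entry A q i)"

lemma hmu_hcnj_hchol_diag:
  assumes "i < dim_row A"
  shows "hmu (hcnj (hchol A $$ (i, i))) \<noteq> 0"
  using assms
  by (auto simp: hchol_def hchol_col_def hchol_scale_def hchol_pivot_def hcnj_def Let_def
      hemi_defs sgn_if)

lemma hchol_X_equation:
  assumes "i < dim_row A" "q < card (hchol_zero_pivots A)"
  shows "hmu (hcnj (hchol A $$ (i, i))) * hchol_X A $$ (i, q) =
    hmu (hchol_Y A $$ (i, q)) -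
      (\<Sum>j\<in>{i<..<dim_row A}. hmu (hcnj (hchol A $$ (j, i))) * hchol_X A $$ (j, q))"
proof -
  have *: "hchol_X A $$ (j, q) = hchol_X_entry A q j" if "j < dim_row A" for j
    using that assms by (simp add: hchol_X_def)
  show ?thesis
    using assms hmu_hcnj_hchol_diag[OF assms(1)]
    by (simp add: * hchol_X_entry.simps[of A q i])
qed

end

theory Submission
  imports Defs
begin

text \<open>Put \<open>y = L\<^sup>* v\<close>. Since \<open>v\<close> is real, associativity causes no trouble and
  \<open>L y = A v = 0\<close>. A pure-hemi solution of \<open>L y = 0\<close> is not determined by forward substitution,
  but for a nonzero pivot \<open>i\<close> every entry of column \<open>i\<close> of \<open>L\<close> is a real multiple of \<open>L\<^sub>i\<^sub>i\<close>, so
  \<open>y\<^sub>i\<close> is a real multiple of the conjugate of \<open>L\<^sub>i\<^sub>i\<close> and must be the symmetric quotient; for a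
  zero pivot only the \<open>\<mu>\<close>-part of \<open>y\<^sub>i\<close> remains free. Hence \<open>y = Y \<alpha>\<close>, where \<open>\<alpha>\<close> collects the
  \<open>\<mu>\<close>-parts of \<open>y\<close> at the zero pivots. The \<open>\<mu>\<close>-part of \<open>L\<^sup>* v = Y \<alpha>\<close> is the nonsingular
  triangular system that is also solved by \<open>X \<alpha>\<close>.\<close>

section \<open>Linearity of products and of symmetric division\<close>

lemma hemiplex_sel_sum:
  "hre (\<Sum>x\<in>S. f x) = (\<Sum>x\<in>S. hre (f x))"
  "hmu (\<Sum>x\<in>S. f x) = (\<Sum>x\<in>S. hmu (f x))"
  "hnu (\<Sum>x\<in>S. f x) = (\<Sum>x\<in>S. hnu (f x))"
  by (induction S rule: infinite_finite_induct) (simp_all add: hemi_defs)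

lemma hcnj_sel [simp]: "hre (hcnj z) = hre z" "hmu (hcnj z) = - hmu z" "hnu (hcnj z) = - hnu z"
  by (simp_all add: hcnj_def)

text \<open>Real coefficients leave the product by bilinearity alone, which stands in for the
  missing associativity.\<close>

lemma hre_mult_scaleR_sum:
  "hre (z * (\<Sum>x\<in>S. f x *\<^sub>R w x)) = (\<Sum>x\<in>S. f x * hre (z * w x))"
proof -
  have "hre (a + b) = hre a + hre b" "hre (r *\<^sub>R a) = r * hre a" "hre (z * 0) = 0" for a b r
    by (simp_all add: hemi_defs)
  then show ?thesis
    by (induction S rule: infinite_finite_induct) (simp_all add: hemi_mult_bilinear(3,5))
qed

lemma hdiv_sum: "hdiv (\<Sum>x\<in>S. f x * g x) z = (\<Sum>x\<in>S. f x *\<^sub>R hdiv (g x) z)"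
  by (simp add: hdiv_def scaleR_sum_left scaleR_sum_right mult_ac)

text \<open>Here w = t z with t real, z w = -t |z|^2 and the conjugate of z is -z, so the quotient
  is t z. The last two assumptions make |z|^2 = d (\<open>hmu z\<close>)^2 nonzero.\<close>

lemma eq_hdiv:
  assumes "pure_hemi z" "pure_hemi w" "hnu z = d * hmu z" "hnu w = d * hmu w" "d \<noteq> 0" "hmu z \<noteq> 0"
  shows "w = hdiv (hre (z * w)) z"
  using assms
  by (simp add: hdiv_def hnormsq_eq pure_hemi_def hcnj_def hemi_defs field_simps)

section \<open>Columns of L\<close>

lemma hchol_scale_pos: "hchol_scale B j > 0"
  by (auto simp: hchol_scale_def hchol_pivot_def sgn_if)

lemma hchol_scale_square: "(hchol_scale B j)\<^sup>2 * hchol_pivot B j = B j j"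
  by (auto simp: hchol_scale_def hchol_pivot_def sgn_if)

lemma hchol_col_eq_0: "i < j \<Longrightarrow> hchol_col B j i = 0"
  by (simp add: hchol_col_def)

text \<open>For d = 1 or d = -1, d \<mu> + \<nu> = d (\<mu> + d \<nu>), so the off-diagonal entries
  lie on the real line of the diagonal one.\<close>

lemma hchol_col_nonzero_pivot:
  assumes "hchol_pivot B j \<noteq> 0"
  shows "hnu (hchol_col B j i) = hchol_pivot B j * hmu (hchol_col B j i)"
proof -
  have "hchol_pivot B j * hchol_pivot B j = 1"
    using assms by (auto simp: hchol_pivot_def sgn_if)
  then show ?thesis
    by (simp add: hchol_col_def Let_def hemi_defs algebra_simps)
qed

lemma hmu_hchol_col_diag: "hmu (hchol_col B j j) \<noteq> 0"
  using hchol_scale_pos[of B j] by (simp add: hchol_col_def Let_def hemi_defs)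

lemma hchol_col_zero_pivot:
  assumes "hchol_pivot B j = 0"
  shows "hmu (hchol_col B j i) = (if i = j then 1 else 0)" "hnu (hchol_col B j j) = 0"
  using assms by (auto simp: hchol_col_def hchol_scale_def hchol_pivot_def Let_def hemi_defs sgn_if
      split: if_splits)

text \<open>The scaling of column \<open>j\<close> is chosen for this: the update then clears column
  \<open>j\<close> of the Schur complement.\<close>

lemma hchol_col_mult_diag:
  assumes "j \<le> i"
  shows "hre (hchol_col B j i * hcnj (hchol_col B j j)) = B i j"
proof (cases "i = j")
  case True
  then show ?thesis
    using hchol_scale_square[of B j]
    by (simp add: hchol_col_def Let_def hemi_defs power2_eq_square algebra_simps)
next
  case False
  define d l where "d = hchol_pivot B j" and "l = hchol_scale B j"
  define t where "t = 2 * B i j / (l * (1 + d\<^sup>2))"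
  have "l > 0" "1 + d\<^sup>2 \<noteq> 0"
    using hchol_scale_pos[of B j] by (auto simp: l_def add_nonneg_eq_0_iff)
  \<comment> \<open>(d \<mu> + \<nu>) times the conjugate of \<mu> + d \<nu> is (1 + d^2) /
    2.\<close>
  have "hre (hchol_col B j i * hcnj (hchol_col B j j)) = t * l * (1 + d\<^sup>2) / 2"
    using assms False
    by (simp add: hchol_col_def Let_def flip: d_def l_def t_def)
      (simp add: hemi_defs power2_eq_square field_simps)
  also have "\<dots> = B i j"
    using \<open>l > 0\<close> \<open>1 + d\<^sup>2 \<noteq> 0\<close> by (simp add: t_def)
  finally show ?thesis .
qed

section \<open>The identity A = L L^*\<close>

lemma hre_mult_hcnj_commute: "hre (z * hcnj w) = hre (w * hcnj z)"
  by (simp add: hemi_defs)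

lemma hchol_schur_sym:
  assumes "A \<in> carrier_mat K K" "transpose_mat A = A" "i < K" "k < K"
  shows "hchol_schur A j i k = hchol_schur A j k i"
proof (induction j)
  case 0
  have "transpose_mat A $$ (i, k) = A $$ (k, i)"
    using assms(1,3,4) by simp
  then show ?case
    using assms(2) by simp
next
  case (Suc j)
  then show ?case
    by (simp add: hre_mult_hcnj_commute)
qed

lemma hchol_schur_sum:
  "hchol_schur A n i k = A $$ (i, k) -
    (\<Sum>j<n. hre (hchol_col (hchol_schur A j) j i * hcnj (hchol_col (hchol_schur A j) j k)))"
  by (induction n) simp_all

lemma hchol_schur_Suc_eq_0: "j \<le> i \<Longrightarrow> hchol_schur A (Suc j) i j = 0"
  by (simp add: hchol_col_mult_diag)

text \<open>The Schur complements telescope, and entry (i, k) is cleared once the smaller of its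
  indices is eliminated.\<close>

lemma hchol_factorization:
  assumes "A \<in> carrier_mat K K" "transpose_mat A = A" "i < K" "k < K"
  shows "A $$ (i, k) =
    (\<Sum>j\<le>i. hre (hchol_col (hchol_schur A j) j i * hcnj (hchol_col (hchol_schur A j) j k)))"
    (is "_ = (\<Sum>j\<le>i. ?p j)")
proof -
  \<comment> \<open>Elimination is known to clear rows from the pivot on; symmetry reduces k > i to
    this case.\<close>
  have "hchol_schur A (Suc (min i k)) i k = 0"
  proof (cases "k \<le> i")
    case True
    then show ?thesis
      using hchol_schur_Suc_eq_0[of k i A] by (simp add: min_absorb2)
  next
    case False
    then show ?thesis
      using hchol_schur_Suc_eq_0[of i k A] hchol_schur_sym[OF assms, of "Suc i"]
      by (simp add: min_absorb1)
  qed
  then have "A $$ (i, k) = (\<Sum>j<Suc (min i k). ?p j)"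
    using hchol_schur_sum[of A "Suc (min i k)" i k] by linarith
  also have "\<dots> = (\<Sum>j\<le>i. ?p j)"
  proof (rule sum.mono_neutral_left)
    show "\<forall>j\<in>{..i} - {..<Suc (min i k)}. ?p j = 0"
    proof
      fix j assume "j \<in> {..i} - {..<Suc (min i k)}"
      then have "k < j"
        by auto
      then show "?p j = 0"
        by (simp add: hchol_col_eq_0 hcnj_def hemi_defs)
    qed
  qed auto
  finally show ?thesis .
qed

section \<open>Forward substitution for L y = 0\<close>

lemma hchol_index:
  "i < dim_row A \<Longrightarrow> j < dim_row A \<Longrightarrow> hchol A $$ (i, j) = hchol_col (hchol_schur A j) j i"
  by (simp add: hchol_def)

text \<open>Row \<open>i\<close> of \<open>L y\<close>, truncated to the entries that forward substitution knows already.\<close>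

definition hchol_known :: "real mat \<Rightarrow> (nat \<Rightarrow> hemiplex) \<Rightarrow> nat \<Rightarrow> real" where
  "hchol_known A y i = (\<Sum>j<i. hre (hchol A $$ (i, j) * y j))"

lemma hchol_known_Y_col_eq_0: "i \<le> s \<Longrightarrow> hchol_known A (hchol_Y_col A s) i = 0"
  by (auto simp: hchol_known_def hchol_Y_col.simps[of A s] hemi_defs intro!: sum.neutral)

text \<open>Rows before \<open>s\<close> are included, as both sides vanish there.\<close>

lemma hchol_Y_col_nonzero_pivot:
  assumes "i \<notin> hchol_zero_pivots A" "s \<in> hchol_zero_pivots A"
  shows "hchol_Y_col A s i = hdiv (- hchol_known A (hchol_Y_col A s) i) (hchol A $$ (i, i))"
proof (cases "i < s")
  case True
  then show ?thesis
    by (simp add: hchol_known_Y_col_eq_0 hchol_Y_col.simps[of A s i] hdiv_def)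
next
  case False
  then show ?thesis
    using assms
    by (auto simp: hchol_Y_col.simps[of A s i] hchol_known_def Let_def hemiplex_sel_sum)
qed

text \<open>Merging the cases i < s, i = s and i > s allows summation over \<open>s\<close> without
  a case split.\<close>

lemma hchol_Y_col_zero_pivot:
  assumes "i \<in> hchol_zero_pivots A"
  shows "hchol_Y_col A s i =
    (if s = i then hemi_mu else 0) + (2 * hchol_known A (hchol_Y_col A s) i) *\<^sub>R hemi_nu"
proof (cases "i \<le> s")
  case True
  then show ?thesis
    by (simp add: hchol_known_Y_col_eq_0 hchol_Y_col.simps[of A s i])
next
  case False
  then show ?thesis
    using assms
    by (simp add: hchol_Y_col.simps[of A s i] hchol_known_def Let_def hemiplex_sel_sum)
qed

lemma finite_hchol_zero_pivots [simp]: "finite (hchol_zero_pivots A)"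
  by (simp add: hchol_zero_pivots_def)

text \<open>Strong induction on the row: the earlier entries of \<open>y\<close> combine the columns
  of Y with fixed coefficients, hence so does \<open>hchol_known\<close>, and row \<open>i\<close>
  of L y = 0 then settles \<open>y i\<close>.\<close>

lemma hchol_kernel_in_Y_span:
  fixes v :: "nat \<Rightarrow> real"
  assumes A: "A \<in> carrier_mat K K" "transpose_mat A = A"
    and ker: "\<And>i. i < K \<Longrightarrow> (\<Sum>k<K. v k * A $$ (i, k)) = 0"
    and y: "\<And>j. y j = (\<Sum>k<K. v k *\<^sub>R hcnj (hchol A $$ (k, j)))"
    and "i < K"
  shows "y i = (\<Sum>s\<in>hchol_zero_pivots A. hmu (y s) *\<^sub>R hchol_Y_col A s i)"
  using \<open>i < K\<close>
proof (induction i rule: less_induct)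
  case (less i)
  let ?S = "hchol_zero_pivots A"
  define c where "c = (\<lambda>j. hchol_col (hchol_schur A j) j)"
  have L: "hchol A $$ (k, j) = c j k" if "k < K" "j < K" for k j
    using that A by (simp add: hchol_index c_def)
  have y': "y j = (\<Sum>k<K. v k *\<^sub>R hcnj (c j k))" if "j < K" for j
    unfolding y using that by (intro sum.cong) (simp_all add: L)
  have pure: "pure_hemi (c j k)" for j k
    by (simp add: c_def pure_hemi_hchol_col)
  have pure_y: "hre (y i) = 0"
    using pure less.prems by (simp add: y' hemiplex_sel_sum pure_hemi_def hemi_defs)
  have "0 = (\<Sum>k<K. v k * A $$ (i, k))"
    using ker less.prems by simp
  also have "\<dots> = (\<Sum>k<K. \<Sum>j\<le>i. v k * hre (c j i * hcnj (c j k)))"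
    using less.prems
    by (intro sum.cong) (simp_all add: hchol_factorization[OF A] c_def sum_distrib_left)
  \<comment> \<open>Exchanging the sums turns row \<open>i\<close> of A v into row \<open>i\<close>
    of L y; this rests on \<open>v\<close> being real.\<close>
  also have "\<dots> = (\<Sum>j\<le>i. hre (c j i * y j))"
    using less.prems by (subst sum.swap) (simp add: y' hre_mult_scaleR_sum)
  also have "\<dots> = hchol_known A y i + hre (c i i * y i)"
    using less.prems by (simp add: hchol_known_def L flip: lessThan_Suc_atMost)
  finally have diag: "hre (c i i * y i) = - hchol_known A y i"
    by simp
  have "hchol_known A y i =
      (\<Sum>j<i. hre (hchol A $$ (i, j) * (\<Sum>s\<in>?S. hmu (y s) *\<^sub>R hchol_Y_col A s j)))"
    unfolding hchol_known_def
  proof (rule sum.cong)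
    fix j assume "j \<in> {..<i}"
    then show "hre (hchol A $$ (i, j) * y j) =
        hre (hchol A $$ (i, j) * (\<Sum>s\<in>?S. hmu (y s) *\<^sub>R hchol_Y_col A s j))"
      using less.IH[of j] less.prems by simp
  qed simp
  also have "\<dots> = (\<Sum>s\<in>?S. hmu (y s) * hchol_known A (hchol_Y_col A s) i)"
    by (simp add: hre_mult_scaleR_sum hchol_known_def sum_distrib_left sum.swap[of _ ?S])
  finally have known: "hchol_known A y i =
      (\<Sum>s\<in>?S. hmu (y s) * hchol_known A (hchol_Y_col A s) i)" .
  show ?case
  proof (cases "i \<in> ?S")
    case True
    then have pivot: "hchol_pivot (hchol_schur A i) i = 0"
      by (simp add: hchol_zero_pivots_def)
    \<comment> \<open>The diagonal entry is \<mu>, which annihilates the \<mu>-part of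
      \<open>y i\<close>: row \<open>i\<close> fixes only the \<nu>-part.\<close>
    have "hre (c i i * y i) = - hnu (y i) / 2"
      using hchol_col_zero_pivot[OF pivot] pure_y pure[of i i]
      by (simp add: c_def hemi_defs pure_hemi_def)
    then have "hnu (y i) = 2 * hchol_known A y i"
      using diag by simp
    then have "y i = hmu (y i) *\<^sub>R hemi_mu + (2 * hchol_known A y i) *\<^sub>R hemi_nu"
      using pure_y by (simp add: hemi_defs)
    also have "hmu (y i) *\<^sub>R hemi_mu = (\<Sum>s\<in>?S. hmu (y s) *\<^sub>R (if s = i then hemi_mu else 0))"
      using True by (simp add: if_distrib sum.delta cong: if_cong)
    also have "\<dots> + (2 * hchol_known A y i) *\<^sub>R hemi_nu =
        (\<Sum>s\<in>?S. hmu (y s) *\<^sub>R hchol_Y_col A s i)"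
      by (simp add: known hchol_Y_col_zero_pivot[OF True] scaleR_add_right sum.distrib
          sum_distrib_left scaleR_sum_left mult_ac)
    finally show ?thesis .
  next
    case False
    then have pivot: "hchol_pivot (hchol_schur A i) i \<noteq> 0"
      using less.prems A by (auto simp: hchol_zero_pivots_def)
    \<comment> \<open>\<open>y i\<close> is a real combination of conjugates of entries of column
      \<open>i\<close>, so it stays on their line.\<close>
    have "hnu (y i) = hchol_pivot (hchol_schur A i) i * hmu (y i)"
      using less.prems hchol_col_nonzero_pivot[OF pivot]
      by (simp add: y' hemiplex_sel_sum c_def scaleR_hemiplex_def sum_distrib_left mult_ac
          sum_negf)
    then have "y i = hdiv (hre (c i i * y i)) (c i i)"
      using pivot pure pure_y hchol_col_nonzero_pivot[OF pivot, of i]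
      by (intro eq_hdiv[where d = "hchol_pivot (hchol_schur A i) i"])
        (simp_all add: c_def pure_hemi_def hmu_hchol_col_diag)
    also have "hre (c i i * y i) = (\<Sum>s\<in>?S. hmu (y s) * - hchol_known A (hchol_Y_col A s) i)"
      by (simp add: diag known sum_negf)
    also have "hdiv \<dots> (c i i) = (\<Sum>s\<in>?S. hmu (y s) *\<^sub>R hchol_Y_col A s i)"
      unfolding hdiv_sum using False less.prems
      by (intro sum.cong) (simp_all add: hchol_Y_col_nonzero_pivot L)
    finally show ?thesis .
  qed
qed

section \<open>Back substitution in the \<mu>-part of L^* v = y\<close>

lemma upper_triangular_system_unique:
  fixes u w :: "nat \<Rightarrow> 'a :: idom"
  assumes diag: "\<And>i. i < K \<Longrightarrow> T i i \<noteq> 0"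
    and "\<And>i. i < K \<Longrightarrow> T i i * u i = b i - (\<Sum>j\<in>{i<..<K}. T j i * u j)"
    and "\<And>i. i < K \<Longrightarrow> T i i * w i = b i - (\<Sum>j\<in>{i<..<K}. T j i * w j)"
    and "i < K"
  shows "u i = w i"
  using \<open>i < K\<close>
\<comment> \<open>The induction runs from the last row up. \<open>T\<close> is indexed like L, while
  the system is that of its transpose.\<close>
proof (induction "K - i" arbitrary: i rule: less_induct)
  case less
  have "u j = w j" if "j \<in> {i<..<K}" for j
    using less.hyps[of j] that by (simp add: diff_less_mono2)
  then have "T i i * u i = T i i * w i"
    using assms less.prems by simp
  then show ?case
    using diag less.prems by simp
qed

theorem corollary5p4:
  fixes A :: "real mat" and v :: "real vec" and K :: nat
  assumes "A \<in> carrier_mat K K" and "transpose_mat A = A"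
    and "v \<in> carrier_vec K" and "A *\<^sub>v v = 0\<^sub>v K"
  shows "\<exists>\<alpha> \<in> carrier_vec (card (hchol_zero_pivots A)). v = hchol_X A *\<^sub>v \<alpha>"
proof -
  let ?S = "hchol_zero_pivots A"
  let ?e = "\<lambda>q. sorted_list_of_set ?S ! q"
  let ?T = "\<lambda>j i. hmu (hcnj (hchol A $$ (j, i)))"
  define y where "y j = (\<Sum>k<K. (v $ k) *\<^sub>R hcnj (hchol A $$ (k, j)))" for j
  define \<alpha> where "\<alpha> = vec (card ?S) (\<lambda>q. hmu (y (?e q)))"
  have dim [simp]: "dim_row A = K" "dim_col A = K" "dim_vec v = K"
    using assms by auto
  have ker: "(\<Sum>k<K. v $ k * A $$ (i, k)) = 0" if "i < K" for i
  proof -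
    have "(A *\<^sub>v v) $ i = 0"
      using assms(4) that by simp
    then show ?thesis
      using that by (simp add: scalar_prod_def mult.commute atLeast0LessThan)
  qed
  \<comment> \<open>Passes from sums over zero pivots to sums over column numbers.\<close>
  have bij: "bij_betw ?e {..<card ?S} ?S"
    by (rule bij_betw_nth) (simp_all add: distinct_card)
  have Y: "hmu (y i) = (\<Sum>q<card ?S. \<alpha> $ q * hmu (hchol_Y A $$ (i, q)))" if "i < K" for i
  proof -
    have "hmu (y i) = (\<Sum>s\<in>?S. hmu (y s) * hmu (hchol_Y_col A s i))"
      by (subst hchol_kernel_in_Y_span[OF assms(1,2) ker y_def that])
        (simp_all add: hemiplex_sel_sum scaleR_hemiplex_def)
    also have "\<dots> = (\<Sum>q<card ?S. \<alpha> $ q * hmu (hchol_Y A $$ (i, q)))"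
      using that
      by (subst sum.reindex_bij_betw[OF bij, symmetric]) (simp add: \<alpha>_def hchol_Y_def)
    finally show ?thesis .
  qed
  have X: "(hchol_X A *\<^sub>v \<alpha>) $ i = (\<Sum>q<card ?S. \<alpha> $ q * hchol_X A $$ (i, q))" if "i < K" for i
    using that
    by (simp add: \<alpha>_def hchol_X_def scalar_prod_def atLeast0LessThan mult.commute)
  have "v $ i = (hchol_X A *\<^sub>v \<alpha>) $ i" if "i < K" for i
  proof (rule upper_triangular_system_unique[where T = ?T and b = "\<lambda>i. hmu (y i)" and K = K])
    fix i assume "i < K"
    have "hmu (y i) = (\<Sum>k<K. ?T k i * v $ k)"
      by (simp add: y_def hemiplex_sel_sum scaleR_hemiplex_def mult.commute)
    \<comment> \<open>L is lower triangular, so the terms with k < i vanish.\<close>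
    also have "\<dots> = (\<Sum>k\<in>insert i {i<..<K}. ?T k i * v $ k)"
      using \<open>i < K\<close>
      by (intro sum.mono_neutral_right) (auto simp: hchol_index hchol_col_eq_0 hemi_defs)
    also have "\<dots> = ?T i i * v $ i + (\<Sum>k\<in>{i<..<K}. ?T k i * v $ k)"
      by simp
    finally show "?T i i * v $ i = hmu (y i) - (\<Sum>k\<in>{i<..<K}. ?T k i * v $ k)"
      by linarith
  next
    fix i assume i: "i < K"
    \<comment> \<open>The equations for the columns of X are weighted by \<alpha> and added; their
      right-hand sides add up to the \<mu>-part of \<open>y\<close>.\<close>
    have "?T i i * (hchol_X A *\<^sub>v \<alpha>) $ i = (\<Sum>q<card ?S. \<alpha> $ q * (?T i i * hchol_X A $$ (i, q)))"
      using i by (simp only: X sum_distrib_left mult.left_commute)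
    also have "\<dots> = (\<Sum>q<card ?S. \<alpha> $ q * (hmu (hchol_Y A $$ (i, q)) -
        (\<Sum>j\<in>{i<..<K}. ?T j i * hchol_X A $$ (j, q))))"
      using i hchol_X_equation[of i A] by (intro sum.cong) simp_all
    also have "\<dots> = hmu (y i) -
        (\<Sum>j\<in>{i<..<K}. ?T j i * (\<Sum>q<card ?S. \<alpha> $ q * hchol_X A $$ (j, q)))"
      by (simp only: Y[OF i] right_diff_distrib sum_subtractf sum_distrib_left mult.left_commute
          sum.swap[of _ "{i<..<K}"])
    also have "\<dots> = hmu (y i) - (\<Sum>j\<in>{i<..<K}. ?T j i * (hchol_X A *\<^sub>v \<alpha>) $ j)"
      by (simp add: X)
    finally show "?T i i * (hchol_X A *\<^sub>v \<alpha>) $ i =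
        hmu (y i) - (\<Sum>j\<in>{i<..<K}. ?T j i * (hchol_X A *\<^sub>v \<alpha>) $ j)" .
  qed (use that hmu_hcnj_hchol_diag in auto)
  then have "v = hchol_X A *\<^sub>v \<alpha>"
    by (intro eq_vecI) (simp_all add: hchol_X_def)
  moreover have "\<alpha> \<in> carrier_vec (card ?S)"
    by (simp add: \<alpha>_def)
  ultimately show ?thesis
    by blast
qed

end
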